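(* Suppose the Ramsey number $R_{\mathbb{G}}(\mathbb{X},\mathcal{C})$ (maximal base $\mathbb{G}=\{G_i\}_{i\in I}$) exists and is of Galois type with $q$ colors. Treat $p[G_i,\mathbb{X},\mathcal{C}]$ as an element of the ring $\mathcal{P}(\mathbb{F}_q^{(E(G_i))},\mathbb{F}_q)$ of polynomial functions, and write $i_m=\max\{i\in I: p[G_i,\mathbb{X},\mathcal{C}]\neq 0\}$ and $i_k=\min\{i\in I: p[G_i,\mathbb{X},\mathcal{C}]=0\}$. Then $i_{m+1}=R_{\mathbb{G}}(\mathbb{X},\mathcal{C})=i_k$, where $i_{m+1}$ denotes the successor of $i_m$ in $I$.
   Context: All graphs are finite and undirected; $\mathrm{Hom}(G,A)$ is the set of maps $E(G)\to A$. The isomorphism set $G/X$ is the set of edge maps $\pi:E(Y)\to E(X)$ induced by graph isomorphisms $V(Y)\to V(X)$, $Y$ ranging over subgraphs of $G$; $\pi^{-1}(X)$ denotes $E(Y)$, and "$\rho|_{\pi^{-1}(X)}=\psi\circ\pi$" means $\rho(e)=\psi(\pi(e))$ for all $e\in E(Y)$. $I$ is a strictly well-ordered index set. $\mathbb{G}=\{G_i\}_{i\in I}$ is hereditary: for all $0<i\le k$ in $I$ ($0$ the least element), every $G_s$ with $s<i$ satisfies $G_t/G_s\neq\emptyset$ for all $t\ge k$. Galois type with maximal base: there is a color set $A$ with $|A|=q$ a prime power, identified with $\mathbb{F}_q$; the admissible colorings at index $i$ are all of $\mathrm{Hom}(G_i,\mathbb{F}_q)$; the symbol is uniform and of finite type: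 a fixed finite family $\mathbb{X}=\{X_j\}_{j\in J}$ with colorings $\mathcal{C}=\{\psi_j\}_{j\in J}$, $\psi_j\in\mathrm{Hom}(X_j,\mathbb{F}_q)$, used at every index. $R_{\mathbb{G}}(\mathbb{X},\mathcal{C})$ is the least $n\in I$ (if any) such that for all $t\ge n$ and all $\rho\in\mathrm{Hom}(G_t,\mathbb{F}_q)$ there exist $j\in J$, $\pi\in G_t/X_j$ with $\rho|_{\pi^{-1}(X_j)}=\psi_j\circ\pi$. Colorings $\rho\in\mathrm{Hom}(G,\mathbb{F}_q)$ are identified with points of $\mathbb{F}_q^{(E(G))}$. $p[G,X,\psi](x)=\prod_{\pi\in G/X}\big(1-\prod_{e\in\pi^{-1}(X)}(1-(x_e-\psi(\pi(e)))^{q-1})\big)$ and $p[G,\mathbb{X},\mathcal{C}]=\prod_{j\in J}p[G,X_j,\psi_j]$. *)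

theory Defs
  imports "HOL-Algebra.Ring" "HOL-Library.Cardinality"
begin

text \<open>Edges are sets \<open>{u, v}\<close> of vertices. Loops (\<open>u = v\<close>) are not excluded; simple graphs are
  the special case without loops, and subgraphs of simple graphs are simple.\<close>

record 'v ugraph =
  verts :: "'v set"
  edges :: "'v set set"

definition fin_graph :: "'v ugraph \<Rightarrow> bool" where
  "fin_graph G \<longleftrightarrow> finite (verts G) \<and> (\<forall>e\<in>edges G. \<exists>u\<in>verts G. \<exists>v\<in>verts G. e = {u, v})"

definition subgraph :: "'v ugraph \<Rightarrow> 'v ugraph \<Rightarrow> bool" where
  "subgraph Y G \<longleftrightarrow> fin_graph Y \<and> verts Y \<subseteq> verts G \<and> edges Y \<subseteq> edges G"

definition graph_iso :: "('v \<Rightarrow> 'w) \<Rightarrow> 'v ugraph \<Rightarrow> 'w ugraph \<Rightarrow> bool" where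
  "graph_iso f Y X \<longleftrightarrow> bij_betw f (verts Y) (verts X) \<and>
     (\<forall>u\<in>verts Y. \<forall>v\<in>verts Y. {u, v} \<in> edges Y \<longleftrightarrow> {f u, f v} \<in> edges X)"

text \<open>The set \<open>G/X\<close>. An edge map \<open>\<pi> : E(Y) \<rightarrow> E(X)\<close> is a partial map with \<open>dom \<pi> = E(Y)\<close>, so that
  \<open>\<pi>\<close> determines \<open>\<pi>\<^sup>-\<^sup>1(X) = E(Y)\<close>. Vertex isomorphisms inducing the same edge map are
  identified.\<close>

definition iso_set :: "'v ugraph \<Rightarrow> 'w ugraph \<Rightarrow> ('v set \<rightharpoonup> 'w set) set" where
  "iso_set G X = {(\<lambda>e. if e \<in> edges Y then Some (f ` e) else None) | Y f.
                    subgraph Y G \<and> graph_iso f Y X}"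

text \<open>\<open>Hom(G, A)\<close> for \<open>A\<close> the whole type \<open>'a\<close>; also the set of points of the affine
  space \<open>A\<^sup>E\<close> with \<open>E = E(G)\<close>.\<close>

definition points :: "'e set \<Rightarrow> ('e \<Rightarrow> 'a) set" where
  "points E = E \<rightarrow>\<^sub>E UNIV"

definition Hom :: "'v ugraph \<Rightarrow> ('v set \<Rightarrow> 'a) set" where
  "Hom G = points (edges G)"

definition hereditary :: "('i::wellorder \<Rightarrow> 'v ugraph) \<Rightarrow> bool" where
  "hereditary G \<longleftrightarrow> (\<forall>i k. (LEAST z. True) < i \<and> i \<le> k \<longrightarrow>
     (\<forall>s<i. \<forall>t\<ge>k. iso_set (G t) (G s) \<noteq> {}))"

definition ramsey_bound ::
  "('i::wellorder \<Rightarrow> 'v ugraph) \<Rightarrow> 'j set \<Rightarrow> ('j \<Rightarrow> 'w ugraph) \<Rightarrow> ('j \<Rightarrow> 'w set \<Rightarrow> 'a) \<Rightarrow> 'i \<Rightarrow> bool" where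
  "ramsey_bound G J X \<psi> n \<longleftrightarrow> (\<forall>t\<ge>n. \<forall>\<rho>\<in>Hom (G t).
     \<exists>j\<in>J. \<exists>\<pi>\<in>iso_set (G t) (X j). \<forall>e\<in>dom \<pi>. \<rho> e = \<psi> j (the (\<pi> e)))"

definition ramsey_exists ::
  "('i::wellorder \<Rightarrow> 'v ugraph) \<Rightarrow> 'j set \<Rightarrow> ('j \<Rightarrow> 'w ugraph) \<Rightarrow> ('j \<Rightarrow> 'w set \<Rightarrow> 'a) \<Rightarrow> bool" where
  "ramsey_exists G J X \<psi> \<longleftrightarrow> (\<exists>n. ramsey_bound G J X \<psi> n)"

definition ramsey_number ::
  "('i::wellorder \<Rightarrow> 'v ugraph) \<Rightarrow> 'j set \<Rightarrow> ('j \<Rightarrow> 'w ugraph) \<Rightarrow> ('j \<Rightarrow> 'w set \<Rightarrow> 'a) \<Rightarrow> 'i" where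
  "ramsey_number G J X \<psi> = (LEAST n. ramsey_bound G J X \<psi> n)"

text \<open>Polynomial functions on \<open>A\<^sup>E\<close> are represented by functions that are \<open>undefined\<close> outside
  \<^term>\<open>points E\<close>, so that equality in the ring is equality at every point of \<open>A\<^sup>E\<close>.\<close>

inductive_set poly_funs :: "'e set \<Rightarrow> (('e \<Rightarrow> 'a::comm_ring_1) \<Rightarrow> 'a) set" for E where
  const: "(\<lambda>x\<in>points E. c) \<in> poly_funs E"
| coord: "e \<in> E \<Longrightarrow> (\<lambda>x\<in>points E. x e) \<in> poly_funs E"
| add: "f \<in> poly_funs E \<Longrightarrow> g \<in> poly_funs E \<Longrightarrow> (\<lambda>x\<in>points E. f x + g x) \<in> poly_funs E"
| mult: "f \<in> poly_funs E \<Longrightarrow> g \<in> poly_funs E \<Longrightarrow> (\<lambda>x\<in>points E. f x * g x) \<in> poly_funs E"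

definition poly_fun_ring :: "'e set \<Rightarrow> (('e \<Rightarrow> 'a::comm_ring_1) \<Rightarrow> 'a) ring" where
  "poly_fun_ring E = \<lparr>carrier = poly_funs E,
     mult = (\<lambda>f g. \<lambda>x\<in>points E. f x * g x), one = (\<lambda>x\<in>points E. 1),
     zero = (\<lambda>x\<in>points E. 0), add = (\<lambda>f g. \<lambda>x\<in>points E. f x + g x)\<rparr>"

definition copy_poly ::
  "'v ugraph \<Rightarrow> 'w ugraph \<Rightarrow> ('w set \<Rightarrow> 'a) \<Rightarrow> ('v set \<Rightarrow> 'a::{field,finite}) \<Rightarrow> 'a" where
  "copy_poly G X \<psi> = (\<lambda>x\<in>Hom G. \<Prod>\<pi>\<in>iso_set G X.
     1 - (\<Prod>e\<in>dom \<pi>. 1 - (x e - \<psi> (the (\<pi> e))) ^ (CARD('a) - 1)))"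

definition ramsey_poly ::
  "'v ugraph \<Rightarrow> 'j set \<Rightarrow> ('j \<Rightarrow> 'w ugraph) \<Rightarrow> ('j \<Rightarrow> 'w set \<Rightarrow> 'a)
     \<Rightarrow> ('v set \<Rightarrow> 'a::{field,finite}) \<Rightarrow> 'a" where
  "ramsey_poly G J X \<psi> = (\<lambda>x\<in>Hom G. \<Prod>j\<in>J. copy_poly G (X j) (\<psi> j) x)"

definition vanishing ::
  "('i \<Rightarrow> 'v ugraph) \<Rightarrow> 'j set \<Rightarrow> ('j \<Rightarrow> 'w ugraph) \<Rightarrow> ('j \<Rightarrow> 'w set \<Rightarrow> 'a::{field,finite})
     \<Rightarrow> 'i set" where
  "vanishing G J X \<psi> = {i. ramsey_poly (G i) J X \<psi> = \<zero>\<^bsub>poly_fun_ring (edges (G i))\<^esub>}"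

definition nonvanishing ::
  "('i \<Rightarrow> 'v ugraph) \<Rightarrow> 'j set \<Rightarrow> ('j \<Rightarrow> 'w ugraph) \<Rightarrow> ('j \<Rightarrow> 'w set \<Rightarrow> 'a::{field,finite})
     \<Rightarrow> 'i set" where
  "nonvanishing G J X \<psi> = {i. ramsey_poly (G i) J X \<psi> \<noteq> \<zero>\<^bsub>poly_fun_ring (edges (G i))\<^esub>}"

text \<open>Minimum, maximum and immediate successor are relations because the latter two need not exist
  in a well-order.\<close>

definition is_minimum :: "'i::order set \<Rightarrow> 'i \<Rightarrow> bool" where
  "is_minimum S k \<longleftrightarrow> k \<in> S \<and> (\<forall>i\<in>S. k \<le> i)"

definition is_maximum :: "'i::order set \<Rightarrow> 'i \<Rightarrow> bool" where
  "is_maximum S m \<longleftrightarrow> m \<in> S \<and> (\<forall>i\<in>S. i \<le> m)"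

definition is_successor :: "'i::order \<Rightarrow> 'i \<Rightarrow> bool" where
  "is_successor m k \<longleftrightarrow> is_minimum {i. m < i} k"

lemma poly_funs_outside: "f \<in> poly_funs E \<Longrightarrow> x \<notin> points E \<Longrightarrow> f x = undefined"
  by (induction rule: poly_funs.induct) auto

lemma poly_fun_ring_cring: "cring (poly_fun_ring E :: (('e \<Rightarrow> 'a::comm_ring_1) \<Rightarrow> 'a) ring)"
proof (rule cringI)
  show "abelian_group (poly_fun_ring E :: (('e \<Rightarrow> 'a) \<Rightarrow> 'a) ring)"
  proof (rule abelian_groupI, goal_cases)
    case (6 f)
    have "(\<lambda>x\<in>points E. (\<lambda>x\<in>points E. - 1) x * f x) \<in> poly_funs E"
      using 6 by (intro poly_funs.mult poly_funs.const) (simp add: poly_fun_ring_def)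
    then show ?case
      unfolding poly_fun_ring_def ring.simps partial_object.simps monoid.simps
      by (rule rev_bexI) (simp add: restrict_def fun_eq_iff)
  qed (auto simp: poly_fun_ring_def fun_eq_iff restrict_def add_ac poly_funs_outside
       intro: poly_funs.add[unfolded restrict_def] poly_funs.const[unfolded restrict_def])
  show "comm_monoid (poly_fun_ring E :: (('e \<Rightarrow> 'a) \<Rightarrow> 'a) ring)"
    by (rule comm_monoidI)
      (auto simp: poly_fun_ring_def fun_eq_iff restrict_def mult_ac poly_funs_outside
       intro: poly_funs.mult[unfolded restrict_def] poly_funs.const[unfolded restrict_def])
qed (auto simp: poly_fun_ring_def fun_eq_iff restrict_def algebra_simps)

lemma poly_funs_prod:
  assumes "\<And>a. a \<in> A \<Longrightarrow> (\<lambda>x\<in>points E. h a x) \<in> poly_funs E"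
  shows "(\<lambda>x\<in>points E. \<Prod>a\<in>A. h a x) \<in> poly_funs E"
proof (cases "finite A")
  case True
  then show ?thesis
    using assms
  proof (induction A)
    case (insert a A)
    then have "(\<lambda>x\<in>points E. (\<lambda>x\<in>points E. h a x) x * (\<lambda>x\<in>points E. \<Prod>a\<in>A. h a x) x) \<in> poly_funs E"
      by (intro poly_funs.mult) auto
    with insert show ?case
      by (simp add: restrict_def cong: if_cong)
  qed (simp add: poly_funs.const)
qed (simp add: poly_funs.const)

lemma poly_funs_diff:
  assumes "(\<lambda>x\<in>points E. f x) \<in> poly_funs E" "(\<lambda>x\<in>points E. g x) \<in> poly_funs E"
  shows "(\<lambda>x\<in>points E. f x - g x) \<in> poly_funs E"
proof -
  have "(\<lambda>x\<in>points E. (\<lambda>x\<in>points E. f x) x +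
      (\<lambda>x\<in>points E. (\<lambda>x\<in>points E. - 1) x * (\<lambda>x\<in>points E. g x) x) x) \<in> poly_funs E"
    using assms by (intro poly_funs.add poly_funs.mult poly_funs.const)
  then show ?thesis
    by (simp add: restrict_def cong: if_cong)
qed

lemma ramsey_poly_in_ring:
  fixes \<psi> :: "'j \<Rightarrow> 'w set \<Rightarrow> 'a::{field,finite}"
  shows "ramsey_poly G J X \<psi> \<in> carrier (poly_fun_ring (edges G))"
proof -
  have "(\<lambda>x\<in>points (edges G). copy_poly G (X j) (\<psi> j) x) \<in> poly_funs (edges G)" for j
  proof -
    have "(\<lambda>x\<in>points (edges G). \<Prod>\<pi>\<in>iso_set G (X j).
        1 - (\<Prod>e\<in>dom \<pi>. 1 - (\<Prod>_<CARD('a) - 1. x e - \<psi> j (the (\<pi> e))))) \<in> poly_funs (edges G)"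
    proof (intro poly_funs_prod poly_funs_diff poly_funs.const poly_funs.coord)
      fix \<pi> e assume "\<pi> \<in> iso_set G (X j)" "e \<in> dom \<pi>"
      then show "e \<in> edges G"
        by (auto simp: iso_set_def subgraph_def split: if_splits)
    qed
    then show ?thesis
      by (simp add: copy_poly_def Hom_def restrict_def cong: if_cong)
  qed
  then show ?thesis
    unfolding ramsey_poly_def Hom_def poly_fun_ring_def by (simp add: poly_funs_prod)
qed

end

theory Submission imports Defs
begin

text \<open>By Fermat's little theorem in a finite field the factor of the polynomial belonging to a copy
  \<open>\<pi>\<close> vanishes at a coloring iff that coloring agrees with \<open>\<psi> \<circ> \<pi>\<close>; hence the polynomial at index
  \<open>i\<close> is zero iff every coloring of \<open>G i\<close> contains a prescribed colored copy. Copies compose, so by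
  heredity this property passes to all larger indices. The zero indices therefore form the final
  segment starting at the Ramsey number, and the nonzero ones the initial segment below it.\<close>

text \<open>The condition a Ramsey bound imposes at one index, isolated so that it can be carried
  from one graph to another.\<close>

definition unavoidable ::
  "'v ugraph \<Rightarrow> 'j set \<Rightarrow> ('j \<Rightarrow> 'w ugraph) \<Rightarrow> ('j \<Rightarrow> 'w set \<Rightarrow> 'a) \<Rightarrow> bool" where
  "unavoidable G J X \<psi> \<longleftrightarrow>
     (\<forall>\<rho>\<in>Hom G. \<exists>j\<in>J. \<exists>\<pi>\<in>iso_set G (X j). \<forall>e\<in>dom \<pi>. \<rho> e = \<psi> j (the (\<pi> e)))"

lemma ramsey_bound_iff_unavoidable:
  "ramsey_bound G J X \<psi> n \<longleftrightarrow> (\<forall>t\<ge>n. unavoidable (G t) J X \<psi>)"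
  unfolding ramsey_bound_def unavoidable_def ..

section \<open>Fermat's little theorem and 0/1 indicators\<close>

lemma finite_field_power_card_minus_1:
  fixes a :: "'a::{field,finite}"
  assumes "a \<noteq> 0"
  shows "a ^ (CARD('a) - 1) = 1"
proof -
  let ?P = "\<Prod>x\<in>UNIV - {0::'a}. x"
  \<comment> \<open>Multiplication by \<open>a\<close> permutes the nonzero elements, so it
    preserves their product \<open>?P\<close>, which is nonzero and can be cancelled.\<close>
  have "bij_betw ((*) a) (UNIV - {0}) (UNIV - {0})"
    by (rule bij_betwI[where g = "\<lambda>x. x / a"]) (use assms in auto)
  then have "?P = (\<Prod>x\<in>UNIV - {0}. a * x)"
    by (rule prod.reindex_bij_betw[symmetric])
  also have "\<dots> = a ^ (CARD('a) - 1) * ?P"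
    by (simp add: prod.distrib card_Diff_singleton)
  finally show ?thesis
    by simp
qed

lemma finite_field_power_card_minus_1_indicator:
  fixes a :: "'a::{field,finite}"
  shows "1 - a ^ (CARD('a) - 1) = of_bool (a = 0)"
proof -
  \<comment> \<open>The exponent must be positive, since otherwise the power at \<open>a = 0\<close>
    would be 1 instead of 0.\<close>
  have "card {0, 1 :: 'a} \<le> CARD('a)"
    by (rule card_mono) auto
  then show ?thesis
    using finite_field_power_card_minus_1[of a] by (cases "a = 0") auto
qed

lemma prod_of_bool:
  assumes "finite A"
  shows "(\<Prod>a\<in>A. of_bool (P a) :: 'a::comm_semiring_1) = of_bool (\<forall>a\<in>A. P a)"
  using assms by induction auto

section \<open>Copies of one graph in another\<close>

lemma fin_graph_edge_subset:
  assumes "fin_graph G" "e \<in> edges G"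
  shows "e \<subseteq> verts G"
  using assms unfolding fin_graph_def by fast

lemma finite_edges:
  assumes "fin_graph G"
  shows "finite (edges G)"
proof (rule finite_subset)
  show "edges G \<subseteq> Pow (verts G)"
    using fin_graph_edge_subset[OF assms] by blast
  show "finite (Pow (verts G))"
    using assms by (simp add: fin_graph_def)
qed

lemma iso_setE:
  assumes "\<pi> \<in> iso_set G X"
  obtains Y f where "subgraph Y G" "graph_iso f Y X"
    "\<pi> = (\<lambda>e. if e \<in> edges Y then Some (f ` e) else None)"
  using assms unfolding iso_set_def by blast

lemma graph_iso_edge_image:
  assumes "fin_graph Y" "graph_iso f Y X" "e \<in> edges Y"
  shows "f ` e \<in> edges X"
proof -
  obtain u v where "u \<in> verts Y" "v \<in> verts Y" "e = {u, v}"
    using assms(1,3) unfolding fin_graph_def by blast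
  with assms(2,3) show ?thesis
    by (simp add: graph_iso_def)
qed

lemma iso_set_dom_ran:
  assumes "\<pi> \<in> iso_set G X"
  shows "dom \<pi> \<subseteq> edges G" "ran \<pi> \<subseteq> edges X"
  using assms
  by (auto elim!: iso_setE simp: subgraph_def ran_def graph_iso_edge_image split: if_splits)

text \<open>A copy is a partial map between two finite edge sets. Finiteness matters because a
  product over an infinite set is 1 by convention, whatever its factors.\<close>

lemma finite_iso_set:
  assumes "fin_graph G" "fin_graph X"
  shows "finite (iso_set G X)"
proof (rule finite_subset)
  show "iso_set G X \<subseteq> (\<Union>D\<in>Pow (edges G). {\<pi>. dom \<pi> = D \<and> ran \<pi> \<subseteq> edges X})"
    using iso_set_dom_ran[of _ G X] by blast
  show "finite (\<Union>D\<in>Pow (edges G). {\<pi>. dom \<pi> = D \<and> ran \<pi> \<subseteq> edges X})"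
    using assms by (auto intro!: finite_set_of_finite_maps finite_edges finite_subset[of _ "edges G"])
qed

text \<open>An injection on vertices acts injectively on sets of vertices, hence on edges. This lets
  colorings be transported backwards along a copy.\<close>

lemma iso_set_inj_on:
  assumes "\<pi> \<in> iso_set G X"
  shows "inj_on \<pi> (dom \<pi>)"
proof -
  obtain Y f where Y: "subgraph Y G" "graph_iso f Y X"
    and \<pi>: "\<pi> = (\<lambda>e. if e \<in> edges Y then Some (f ` e) else None)"
    using assms by (rule iso_setE)
  have "inj_on f (verts Y)"
    using Y(2) by (simp add: graph_iso_def bij_betw_def)
  moreover have "e \<subseteq> verts Y" if "e \<in> edges Y" for e
    using Y(1) that by (simp add: subgraph_def fin_graph_edge_subset)
  ultimately have "inj_on ((`) f) (edges Y)"
    by (meson inj_onI inj_on_image_eq_iff)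
  then show ?thesis
    by (auto simp: inj_on_def \<pi> split: if_splits)
qed

lemma iso_set_comp:
  assumes "\<pi> \<in> iso_set G H" "\<sigma> \<in> iso_set H X"
  shows "\<sigma> \<circ>\<^sub>m \<pi> \<in> iso_set G X"
proof -
  obtain Y f where Y: "subgraph Y G" "graph_iso f Y H"
    and \<pi>: "\<pi> = (\<lambda>e. if e \<in> edges Y then Some (f ` e) else None)"
    using assms(1) by (rule iso_setE)
  obtain Z g where Z: "subgraph Z H" "graph_iso g Z X"
    and \<sigma>: "\<sigma> = (\<lambda>e. if e \<in> edges Z then Some (g ` e) else None)"
    using assms(2) by (rule iso_setE)
  \<comment> \<open>\<open>W\<close> is the part of \<open>Y\<close> that \<open>f\<close> maps into
    \<open>Z\<close>; it is the domain of the composite isomorphism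
    \<open>g \<circ> f\<close>.\<close>
  define W where "W = \<lparr>verts = {v \<in> verts Y. f v \<in> verts Z}, edges = {e \<in> edges Y. f ` e \<in> edges Z}\<rparr>"
  have fin: "fin_graph Y" "fin_graph Z"
    using Y(1) Z(1) by (simp_all add: subgraph_def)
  have "\<exists>u\<in>verts W. \<exists>v\<in>verts W. e = {u, v}" if "e \<in> edges W" for e
  proof -
    have "e \<in> edges Y" "f ` e \<subseteq> verts Z"
      using that fin(2) by (auto simp: W_def dest: fin_graph_edge_subset)
    moreover obtain u v where "u \<in> verts Y" "v \<in> verts Y" "e = {u, v}"
      using fin(1) \<open>e \<in> edges Y\<close> unfolding fin_graph_def by blast
    ultimately show ?thesis
      by (auto simp: W_def)
  qed
  moreover have "finite (verts W)"
    using fin(1) by (simp add: W_def fin_graph_def)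
  ultimately have "subgraph W G"
    using Y(1) by (auto simp: subgraph_def fin_graph_def W_def)
  moreover have "graph_iso (g \<circ> f) W X"
  proof -
    have "bij_betw f (verts W) (verts Z)"
      unfolding bij_betw_def
    proof
      show "inj_on f (verts W)"
        using Y(2) by (auto simp: W_def graph_iso_def bij_betw_def intro: inj_on_subset)
      have "verts Z \<subseteq> f ` verts Y"
        using Y(2) Z(1) by (simp add: graph_iso_def subgraph_def bij_betw_def)
      then show "f ` verts W = verts Z"
        by (auto simp: W_def)
    qed
    then have "bij_betw (g \<circ> f) (verts W) (verts X)"
      using Z(2) by (auto simp: graph_iso_def intro: bij_betw_trans)
    moreover have "{u, v} \<in> edges W \<longleftrightarrow> {g (f u), g (f v)} \<in> edges X"
      if "u \<in> verts W" "v \<in> verts W" for u v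
    proof -
      \<comment> \<open>For the backward direction, an edge of \<open>Z\<close> is an edge of
        \<open>H\<close>, so the isomorphism \<open>f\<close> reflects it to an edge of
        \<open>Y\<close>.\<close>
      have "{u, v} \<in> edges W \<longleftrightarrow> {f u, f v} \<in> edges Z"
        using that Y(2) Z(1) by (auto simp: W_def graph_iso_def subgraph_def)
      also have "\<dots> \<longleftrightarrow> {g (f u), g (f v)} \<in> edges X"
        using that Z(2) by (simp add: W_def graph_iso_def)
      finally show ?thesis .
    qed
    ultimately show ?thesis
      by (simp add: graph_iso_def)
  qed
  moreover have "\<sigma> \<circ>\<^sub>m \<pi> = (\<lambda>e. if e \<in> edges W then Some ((g \<circ> f) ` e) else None)"
    by (auto simp: fun_eq_iff map_comp_def \<pi> \<sigma> W_def image_image)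
  ultimately show ?thesis
    unfolding iso_set_def by blast
qed

section \<open>Propagation along copies\<close>

text \<open>A coloring of \<open>G\<close> induces one of \<open>H\<close> through a copy of
  \<open>H\<close> in \<open>G\<close>; a prescribed colored copy found in \<open>H\<close> is then
  composed with that copy.\<close>

lemma unavoidable_lift:
  fixes \<psi> :: "'j \<Rightarrow> 'w set \<Rightarrow> 'a"
  assumes "iso_set (G :: 'v ugraph) H \<noteq> {}" "unavoidable H J X \<psi>"
  shows "unavoidable G J X \<psi>"
  unfolding unavoidable_def
proof
  fix \<rho> :: "'v set \<Rightarrow> 'a" assume "\<rho> \<in> Hom G"
  obtain \<pi> where \<pi>: "\<pi> \<in> iso_set G H"
    using assms(1) by blast
  define \<rho>' where "\<rho>' = (\<lambda>e\<in>edges H. \<rho> (inv_into (dom \<pi>) \<pi> (Some e)))"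
  have pull: "\<rho>' e' = \<rho> e" if "\<pi> e = Some e'" for e e'
  proof -
    have "inv_into (dom \<pi>) \<pi> (Some e') = e"
      using inv_into_f_f[OF iso_set_inj_on[OF \<pi>], of e] that by auto
    moreover have "e' \<in> edges H"
      using iso_set_dom_ran(2)[OF \<pi>] that by (auto intro: ranI)
    ultimately show ?thesis
      by (simp add: \<rho>'_def)
  qed
  have "\<rho>' \<in> Hom H"
    by (simp add: \<rho>'_def Hom_def points_def)
  then obtain j \<sigma> where j: "j \<in> J" and \<sigma>: "\<sigma> \<in> iso_set H (X j)"
    and match: "\<forall>e\<in>dom \<sigma>. \<rho>' e = \<psi> j (the (\<sigma> e))"
    using assms(2) unfolding unavoidable_def by blast
  have "\<rho> e = \<psi> j (the ((\<sigma> \<circ>\<^sub>m \<pi>) e))" if "e \<in> dom (\<sigma> \<circ>\<^sub>m \<pi>)" for e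
  proof -
    obtain e' where "\<pi> e = Some e'" "e' \<in> dom \<sigma>"
      using \<open>e \<in> dom (\<sigma> \<circ>\<^sub>m \<pi>)\<close> by (auto simp: map_comp_Some_iff dom_def)
    then show ?thesis
      using match pull[of e e'] by auto
  qed
  then show "\<exists>j\<in>J. \<exists>\<pi>\<in>iso_set G (X j). \<forall>e\<in>dom \<pi>. \<rho> e = \<psi> j (the (\<pi> e))"
    using j iso_set_comp[OF \<pi> \<sigma>] by blast
qed

lemma hereditary_iso_set:
  fixes G :: "'i::wellorder \<Rightarrow> 'v ugraph"
  assumes "hereditary G" "s < t"
  shows "iso_set (G t) (G s) \<noteq> {}"
proof -
  \<comment> \<open>Heredity is applied with both of its indices \<open>i\<close> and
    \<open>k\<close> equal to \<open>t\<close>, which requires that \<open>t\<close> is not the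
    least index.\<close>
  have "(LEAST z::'i. True) \<le> s"
    by (rule Least_le) simp
  with \<open>s < t\<close> have "(LEAST z::'i. True) < t"
    by simp
  with assms show ?thesis
    unfolding hereditary_def by blast
qed

lemma unavoidable_mono:
  assumes "hereditary G" "s \<le> t" "unavoidable (G s) J X \<psi>"
  shows "unavoidable (G t) J X \<psi>"
  using assms hereditary_iso_set[of G s t] unavoidable_lift[of "G t" "G s"]
  by (cases "s = t") auto

section \<open>Zeros of the Ramsey polynomial\<close>

lemma copy_poly_eq_0_iff:
  fixes \<psi> :: "'w set \<Rightarrow> 'a::{field,finite}"
  assumes "fin_graph G" "fin_graph X" "x \<in> Hom G"
  shows "copy_poly G X \<psi> x = 0 \<longleftrightarrow> (\<exists>\<pi>\<in>iso_set G X. \<forall>e\<in>dom \<pi>. x e = \<psi> (the (\<pi> e)))"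
proof -
  have "finite (dom \<pi>)" if "\<pi> \<in> iso_set G X" for \<pi>
    using iso_set_dom_ran(1)[OF that] finite_edges[OF assms(1)] by (rule finite_subset)
  \<comment> \<open>The inner product is the indicator of agreement on the whole copy, so one minus
    it vanishes exactly at a match. A finite product in a field is zero iff some factor is.\<close>
  then have "(\<Prod>e\<in>dom \<pi>. 1 - (x e - \<psi> (the (\<pi> e))) ^ (CARD('a) - 1)) =
      of_bool (\<forall>e\<in>dom \<pi>. x e = \<psi> (the (\<pi> e)))" if "\<pi> \<in> iso_set G X" for \<pi>
    unfolding finite_field_power_card_minus_1_indicator using that by (simp add: prod_of_bool)
  then show ?thesis
    using finite_iso_set[OF assms(1,2)] assms(3) by (simp add: copy_poly_def)
qed

lemma vanishing_eq:
  fixes \<psi> :: "'j \<Rightarrow> 'w set \<Rightarrow> 'a::{field,finite}"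
  assumes "\<And>i. fin_graph (G i)" "finite J" "\<And>j. j \<in> J \<Longrightarrow> fin_graph (X j)"
  shows "vanishing G J X \<psi> = {i. unavoidable (G i) J X \<psi>}"
proof -
  have "ramsey_poly (G i) J X \<psi> = (\<lambda>x\<in>points (edges (G i)). 0) \<longleftrightarrow>
      (\<forall>x\<in>Hom (G i). \<exists>j\<in>J. copy_poly (G i) (X j) (\<psi> j) x = 0)" for i
    using assms(2) by (auto simp: ramsey_poly_def Hom_def[symmetric] fun_eq_iff restrict_def)
  then show ?thesis
    using assms by (auto simp: vanishing_def poly_fun_ring_def unavoidable_def copy_poly_eq_0_iff)
qed

text \<open>Both sides say that \<open>m < n\<close> with no element strictly in between.\<close>

lemma is_maximum_lessThan_iff_is_successor:
  fixes n :: "'i::linorder"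
  shows "is_maximum {i. i < n} m \<longleftrightarrow> is_successor m n"
  unfolding is_maximum_def is_successor_def is_minimum_def mem_Collect_eq not_less[symmetric]
  by blast

text \<open>When the Ramsey number is the least index or a limit, no largest nonvanishing index
  exists; hence the conditional form and the closing equivalence.\<close>

theorem theorem3:
  fixes G :: "'i::wellorder \<Rightarrow> 'v ugraph"
    and J :: "'j set"
    and X :: "'j \<Rightarrow> 'w ugraph"
    and \<psi> :: "'j \<Rightarrow> 'w set \<Rightarrow> 'a::{field,finite}"
  assumes "\<And>i. fin_graph (G i)"
    and "hereditary G"
    and "finite J"
    and "\<And>j. j \<in> J \<Longrightarrow> fin_graph (X j)"
    and "\<And>j. j \<in> J \<Longrightarrow> \<psi> j \<in> Hom (X j)"
    and "ramsey_exists G J X \<psi>"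
  shows "is_minimum (vanishing G J X \<psi>) (ramsey_number G J X \<psi>)
    \<and> (\<forall>m. is_maximum (nonvanishing G J X \<psi>) m \<longrightarrow> is_successor m (ramsey_number G J X \<psi>))
    \<and> ((\<exists>m. is_maximum (nonvanishing G J X \<psi>) m)
        \<longleftrightarrow> (\<exists>l. is_successor l (ramsey_number G J X \<psi>)))"
proof -
  let ?R = "ramsey_number G J X \<psi>"
  \<comment> \<open>Upward closure under heredity reduces the condition on all
    \<open>t \<ge> n\<close> to the condition at \<open>n\<close> alone.\<close>
  have bound_iff: "ramsey_bound G J X \<psi> n \<longleftrightarrow> unavoidable (G n) J X \<psi>" for n
    using unavoidable_mono[OF assms(2)] by (auto simp: ramsey_bound_iff_unavoidable)
  have R: "ramsey_bound G J X \<psi> ?R"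
    using assms(6) unfolding ramsey_exists_def ramsey_number_def by (auto intro: LeastI)
  have "unavoidable (G i) J X \<psi> \<longleftrightarrow> ?R \<le> i" for i
  proof
    assume "unavoidable (G i) J X \<psi>"
    then show "?R \<le> i"
      unfolding ramsey_number_def by (intro Least_le) (simp add: bound_iff)
  next
    assume "?R \<le> i"
    then show "unavoidable (G i) J X \<psi>"
      using R by (simp add: ramsey_bound_iff_unavoidable)
  qed
  then have V: "vanishing G J X \<psi> = {i. ?R \<le> i}"
    using vanishing_eq[of G J X \<psi>] assms(1,3,4) by simp
  moreover have "nonvanishing G J X \<psi> = - vanishing G J X \<psi>"
    by (auto simp: nonvanishing_def vanishing_def)
  ultimately have "nonvanishing G J X \<psi> = {i. i < ?R}"
    by auto
  then show ?thesis
    by (simp add: V is_maximum_lessThan_iff_is_successor) (simp add: is_minimum_def)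
qed

end
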